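(* Let $\sigma>0$, $T>0$ and $r=\sigma^2/2$. Let $S(t)=e^{(r-\sigma^2/2)t+\sigma B(t)}$ (so that $S(t)=e^{\sigma B(t)}$) for $t\ge 0$, where $B$ is a standard Brownian motion, and let $A(T)=\frac1T\int_0^T S(t)\,dt$. Then, for every integer $m\ge 1$, $$\mathbb{E}\left[A(T)^m\right]=\frac{\Gamma(m)}{\Gamma(2m)}\,(rT)^{-m}\left(-\frac12(-1)^m\binom{2m}{m}+\sum_{\ell=0}^m\binom{2m}{\ell}(-1)^\ell e^{rT(m-\ell)^2}\right).$$
   Context: $B:[0,\infty)\to\mathbb{R}$ is standard Brownian motion: $B(0)=0$, increments are independent, and for $0\le s<t$ the increment $B(t)-B(s)$ is normal with mean $0$ and variance $t-s$ (with continuous paths). $\Gamma$ is the Gamma function. *)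

theory Defs
  imports "HOL-Probability.Probability"
begin

text \<open>
  The process is a family \<open>B t \<omega>\<close> with time first; only times \<open>t \<ge> 0\<close> are
  constrained. The standard deviation is the second argument of
  \<^const>\<open>normal_density\<close>, so variance \<open>t - s\<close> appears as \<open>sqrt (t - s)\<close>. Independence of increments
  is joint independence of the increments along any finite partition
  \<open>0 \<le> u 0 < u 1 < \<dots> < u n\<close>. Every path (not merely almost every path) starts at 0 and is
  continuous; \<open>M\<close> is not assumed complete.
\<close>

locale standard_brownian_motion = prob_space M
  for M :: "'a measure" and B :: "real \<Rightarrow> 'a \<Rightarrow> real" +
  assumes random_variable_B: "t \<ge> 0 \<Longrightarrow> random_variable borel (B t)"
    and B_zero: "\<omega> \<in> space M \<Longrightarrow> B 0 \<omega> = 0"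
    and indep_increments:
      "\<lbrakk>0 \<le> u 0; \<And>i. i < n \<Longrightarrow> u i < u (Suc i)\<rbrakk> \<Longrightarrow>
        indep_vars (\<lambda>_. borel) (\<lambda>i \<omega>. B (u (Suc i)) \<omega> - B (u i) \<omega>) {..<n::nat}"
    and normal_increments:
      "\<lbrakk>0 \<le> s; s < t\<rbrakk> \<Longrightarrow>
        distributed M lborel (\<lambda>\<omega>. B t \<omega> - B s \<omega>) (normal_density 0 (sqrt (t - s)))"
    and continuous_paths: "\<omega> \<in> space M \<Longrightarrow> continuous_on {0..} (\<lambda>t. B t \<omega>)"

end

theory Submission
  imports Defs
begin

text \<open>
  Since \<open>r = \<sigma>\<^sup>2 / 2\<close> cancels the drift, \<open>S t = exp (\<sigma> * B t)\<close>, and the theorem asks for the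
  moments of \<open>I s t = \<integral>\<^bsub>s\<^esub>\<^bsup>t\<^esup> exp (\<sigma> * B u) du\<close> at \<open>s = 0\<close>, \<open>t = T\<close>. Along each path, differentiating
  in the lower limit gives
  \<open>(I s t)^(m + 1) = (m + 1) * \<integral>\<^bsub>s\<^esub>\<^bsup>t\<^esup> exp (\<sigma> * B u) * (I u t)^m du\<close>,
  so each step of an induction on \<open>m\<close> trades one power of the integral for one more factor
  \<open>exp (\<sigma> * B u)\<close> at a time \<open>u\<close> later than all factors already produced. When no power is left,
  only the expectation of a product over finitely many ordered times remains. Such
  a product is the exponential of a linear combination of independent normal increments, and its
  expectation is explicit. Thus only finite-dimensional distributions of \<open>B\<close> enter, and the
  time integrals are exchanged with the expectation by Tonelli's theorem, since every integrand is
  nonnegative.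

  With \<open>K\<^sub>m(x)\<close> for \<open>moment r m x\<close>, stationarity of the increments turns the resulting iterated
  integral into the recursion
  \<open>K\<^sub>m\<^sub>+\<^sub>1(x) = (m + 1) * \<integral>\<^bsub>0\<^esub>\<^bsup>x\<^esup> exp (r * (m + 1)\<^sup>2 * u) * K\<^sub>m(x - u) du\<close>, that is,
  \<open>K\<^sub>m\<^sub>+\<^sub>1' = r * (m + 1)\<^sup>2 * K\<^sub>m\<^sub>+\<^sub>1 + (m + 1) * K\<^sub>m\<close> with \<open>K\<^sub>m\<^sub>+\<^sub>1(0) = 0\<close> and \<open>K\<^sub>0 = 1\<close>. Up to a factor,
  \<open>K\<^sub>m(x)\<close> is the divided difference of \<open>y \<mapsto> exp (r * x * y)\<close> at the nodes \<open>0, 1, 4, \<dots>, m\<^sup>2\<close>.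
  Here it is written as an alternating binomial sum over \<open>l \<le> 2 * m\<close>, symmetric about \<open>l = m\<close>;
  folding this sum onto \<open>l \<le> m\<close> produces the stated formula, including its correction
  term at \<open>l = m\<close>.

  The recursion is \<open>moment_deriv\<close> and \<open>nn_integral_moment\<close>, the pathwise identity is
  \<open>nn_integral_power_tail_integral\<close>, the finite-dimensional formula is \<open>nn_integral_exp_sum\<close>, and
  the induction that joins them is \<open>nn_integral_exp_sum_times_power_area\<close>.
\<close>

section \<open>The moment functions\<close>

text \<open>
  The closed form of the \<open>m\<close>-th moment over a horizon of length \<open>x\<close>. The symmetric range
  \<open>l \<le> 2 * m\<close> makes the passage from \<open>m\<close> to \<open>m + 1\<close> a matter of two absorption identities for
  binomial coefficients.
\<close>
definition moment :: "real \<Rightarrow> nat \<Rightarrow> real \<Rightarrow> real" where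
  "moment r m x = fact m / (fact (2 * m) * r ^ m) *
     (\<Sum>l\<le>2 * m. real (2 * m choose l) * (- 1) ^ l * exp (r * x * (real m - real l)\<^sup>2))"

lemma moment_0: "moment r 0 x = 1"
  by (simp add: moment_def)

lemma moment_at_0: "m > 0 \<Longrightarrow> moment r m 0 = 0"
  using choose_alternating_sum[of "2 * m", where ?'a = real]
  by (simp add: moment_def mult.commute)

text \<open>
  The left factor is \<open>- l * (2 * (m + 1) - l)\<close>, and each of its two factors is absorbed by the
  binomial coefficient. In the differential equation this is what lowers \<open>m\<close>.
\<close>
lemma node_difference_times_choose:
  assumes "0 < l" "l < 2 * Suc m"
  shows "((real (Suc m) - real l)\<^sup>2 - (real (Suc m))\<^sup>2) * real (2 * Suc m choose l) =
    - (2 * real (Suc m) * (2 * real (Suc m) - 1)) * real (2 * m choose (l - 1))"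
proof -
  obtain k where k: "l = Suc k" using assms(1) by (cases l) auto
  have km: "k \<le> 2 * m" using assms k by simp
  have a: "real (Suc k) * real (Suc (Suc (2*m)) choose Suc k) = real (Suc (Suc (2*m))) * real (Suc (2*m) choose k)"
    using binomial_absorption[of k "Suc (2*m)"] by (metis binomial_absorption diff_Suc_1 of_nat_mult)
  have b: "real (Suc (2*m) - k) * real (Suc (2*m) choose k) = real (Suc (2*m)) * real (2*m choose k)"
    using binomial_absorb_comp[of "Suc (2*m)" k] by (metis diff_Suc_1 of_nat_mult)
  have "(real (Suc m) - real l)\<^sup>2 - (real (Suc m))\<^sup>2 = - (real (Suc k) * real (Suc (2*m) - k))"
    using km by (simp add: k of_nat_diff algebra_simps power2_eq_square)
  hence "((real (Suc m) - real l)\<^sup>2 - (real (Suc m))\<^sup>2) * real (2 * Suc m choose l) =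
    - (real (Suc (2*m) - k) * (real (Suc k) * real (Suc (Suc (2*m)) choose Suc k)))"
    by (simp add: k)
  also have "\<dots> = - (real (Suc (Suc (2*m))) * (real (Suc (2*m)) * real (2*m choose k)))"
    unfolding a b[symmetric] by (simp add: mult_ac)
  finally show ?thesis by (simp add: k algebra_simps)
qed

text \<open>
  Each summand is an eigenfunction of differentiation with eigenvalue \<open>r * (m + 1 - l)\<^sup>2\<close>.
  Subtracting \<open>r * (m + 1)\<^sup>2\<close> kills the summands \<open>l = 0\<close> and \<open>l = 2 * (m + 1)\<close>, and the
  others become, after a shift of \<open>l\<close>, those of the moment of order \<open>m\<close>.
\<close>
lemma moment_deriv:
  assumes "r \<noteq> 0"
  shows "(moment r (Suc m) has_real_derivative
    r * (real (Suc m))\<^sup>2 * moment r (Suc m) x + real (Suc m) * moment r m x) (at x)"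
proof -
  let ?c = "fact (Suc m) / (fact (2 * Suc m) * r ^ Suc m) :: real"
  let ?g = "\<lambda>l. real (2 * Suc m choose l) * (- 1) ^ l * exp (r * x * (real (Suc m) - real l)\<^sup>2)"
  let ?h = "\<lambda>l. real (2 * m choose l) * (- 1) ^ l * exp (r * x * (real m - real l)\<^sup>2)"
  have d: "(moment r (Suc m) has_real_derivative
      ?c * (\<Sum>l\<le>2 * Suc m. r * (real (Suc m) - real l)\<^sup>2 * ?g l)) (at x)"
    unfolding moment_def[abs_def]
    by (rule DERIV_cmult DERIV_sum derivative_eq_intros refl | simp add: mult_ac)+
  have "(\<Sum>l\<le>2 * Suc m. r * (real (Suc m) - real l)\<^sup>2 * ?g l) - r * (real (Suc m))\<^sup>2 * (\<Sum>l\<le>2 * Suc m. ?g l)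
      = (\<Sum>l\<le>2 * Suc m. r * ((real (Suc m) - real l)\<^sup>2 - (real (Suc m))\<^sup>2) * ?g l)"
    by (simp add: sum_distrib_left sum_subtractf algebra_simps del: sum.atMost_Suc)
  also have "\<dots> = (\<Sum>l\<in>Suc ` {..2*m}. r * ((real (Suc m) - real l)\<^sup>2 - (real (Suc m))\<^sup>2) * ?g l)"
  proof (rule sum.mono_neutral_right)
    show "\<forall>i\<in>{..2 * Suc m} - Suc ` {..2 * m}.
       r * ((real (Suc m) - real i)\<^sup>2 - (real (Suc m))\<^sup>2) * ?g i = 0"
    proof
      fix i assume i: "i \<in> {..2 * Suc m} - Suc ` {..2 * m}"
      have "i = 0 \<or> i = 2 * Suc m"
      proof (cases i)
        case (Suc k) with i show ?thesis by (auto simp: image_iff)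
      qed simp
      thus "r * ((real (Suc m) - real i)\<^sup>2 - (real (Suc m))\<^sup>2) * ?g i = 0"
        by (auto simp: power2_eq_square algebra_simps)
    qed
  qed auto
  also have "\<dots> = (\<Sum>k\<le>2*m. r * (2 * real (Suc m) * (2 * real (Suc m) - 1)) * ?h k)"
  proof (subst sum.reindex, simp, rule sum.cong)
    fix k assume k: "k \<in> {..2*m}"
    have e: "real (Suc m) - real (Suc k) = real m - real k" by simp
    have "r * ((real (Suc m) - real (Suc k))\<^sup>2 - (real (Suc m))\<^sup>2) * ?g (Suc k)
      = r * (((real (Suc m) - real (Suc k))\<^sup>2 - (real (Suc m))\<^sup>2) * real (2 * Suc m choose Suc k))
         * ((- 1) ^ Suc k * exp (r * x * (real m - real k)\<^sup>2))"
      by (simp only: e mult_ac)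
    also have "\<dots> = r * (2 * real (Suc m) * (2 * real (Suc m) - 1)) * ?h k"
      by (subst node_difference_times_choose) (use k in \<open>auto simp: algebra_simps\<close>)
    finally show "((\<lambda>l. r * ((real (Suc m) - real l)\<^sup>2 - (real (Suc m))\<^sup>2) * ?g l) \<circ> Suc) k =
      r * (2 * real (Suc m) * (2 * real (Suc m) - 1)) * ?h k" by simp
  qed simp
  finally have s: "(\<Sum>l\<le>2 * Suc m. r * (real (Suc m) - real l)\<^sup>2 * ?g l) =
      r * (real (Suc m))\<^sup>2 * (\<Sum>l\<le>2 * Suc m. ?g l) + r * (2 * real (Suc m) * (2 * real (Suc m) - 1)) * (\<Sum>l\<le>2 * m. ?h l)"
    by (simp only: sum_distrib_left[symmetric] diff_eq_eq add.commute)
  have c: "?c * (r * (2 * real (Suc m) * (2 * real (Suc m) - 1))) =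
      real (Suc m) * (fact m / (fact (2 * m) * r ^ m))"
  proof -
    have f: "fact (2 * Suc m) = 2 * real (Suc m) * (2 * real (Suc m) - 1) * fact (2 * m)"
      by (simp add: algebra_simps)
    have nz: "2 * real (Suc m) * (2 * real (Suc m) - 1) \<noteq> 0" by simp
    show ?thesis unfolding f using nz assms by (simp add: divide_simps del: of_nat_Suc)
  qed
  show ?thesis
    by (rule DERIV_cong[OF d], subst s, unfold distrib_left mult.assoc[symmetric] c[unfolded mult.assoc[symmetric]])
       (simp add: moment_def mult_ac del: sum.atMost_Suc fact_Suc)
qed

lemma continuous_on_moment:
  assumes "continuous_on D f"
  shows "continuous_on D (\<lambda>x. moment r m (f x))"
  unfolding moment_def by (intro continuous_intros assms)

text \<open>
  The alternating sum hides the sign, but for \<open>m > 0\<close> the differential equation shows that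
  \<open>exp (- r * m\<^sup>2 * x)\<close> times the moment is nondecreasing in \<open>x\<close>, starting from \<open>0\<close>. The sign is needed
  because the integrals below take values in the extended nonnegative reals.
\<close>
lemma moment_nonneg:
  assumes "r > 0" "x \<ge> 0"
  shows "moment r m x \<ge> 0"
  using assms(2)
proof (induction m arbitrary: x)
  case (Suc m)
  let ?F = "\<lambda>x. exp (- (r * (real (Suc m))\<^sup>2) * x) * moment r (Suc m) x"
  have "?F 0 \<le> ?F x"
  proof (rule DERIV_nonneg_imp_nondecreasing[OF Suc.prems])
    fix y :: real assume y: "0 \<le> y" "y \<le> x"
    have "(?F has_real_derivative exp (- (r * (real (Suc m))\<^sup>2) * y) * (real (Suc m) * moment r m y)) (at y)"
      by (rule derivative_eq_intros moment_deriv refl | use assms(1) in \<open>simp add: algebra_simps; fail\<close>)+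
    moreover have "0 \<le> exp (- (r * (real (Suc m))\<^sup>2) * y) * (real (Suc m) * moment r m y)"
      using Suc.IH y by simp
    ultimately show "\<exists>z. (?F has_real_derivative z) (at y) \<and> 0 \<le> z" by blast
  qed
  thus ?case by (simp add: moment_at_0 zero_le_mult_iff)
qed (simp add: moment_0)

text \<open>
  Variation of constants: by \<open>moment_deriv\<close>, the integrand is the derivative of
  \<open>- exp (r * (m + 1)\<^sup>2 * (u - s)) * K\<^sub>m\<^sub>+\<^sub>1(t - u)\<close>, which vanishes at \<open>u = t\<close>.
\<close>
lemma nn_integral_moment:
  assumes "r > 0" "s \<le> t"
  shows "(\<integral>\<^sup>+u\<in>{s..t}. ennreal (real (Suc m) * (exp (r * (real (Suc m))\<^sup>2 * (u - s)) * moment r m (t - u))) \<partial>lborel)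
    = ennreal (moment r (Suc m) (t - s))"
proof -
  let ?F = "\<lambda>u. - (exp (r * (real (Suc m))\<^sup>2 * (u - s)) * moment r (Suc m) (t - u))"
  have "(\<integral>\<^sup>+u\<in>{s..t}. ennreal (real (Suc m) * (exp (r * (real (Suc m))\<^sup>2 * (u - s)) * moment r m (t - u))) \<partial>lborel)
     = ennreal (?F t - ?F s)"
  proof (rule nn_integral_FTC_Icc[OF _ _ _ assms(2)])
    show "(\<lambda>u. real (Suc m) * (exp (r * (real (Suc m))\<^sup>2 * (u - s)) * moment r m (t - u))) \<in> borel_measurable borel"
      by (intro borel_measurable_continuous_onI continuous_intros continuous_on_moment)
    fix u assume u: "u \<in> {s..t}"
    show "0 \<le> real (Suc m) * (exp (r * (real (Suc m))\<^sup>2 * (u - s)) * moment r m (t - u))"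
      using moment_nonneg assms u by simp
    have moment': "((\<lambda>u. moment r (Suc m) (t - u)) has_real_derivative
      (r * (real (Suc m))\<^sup>2 * moment r (Suc m) (t - u) + real (Suc m) * moment r m (t - u)) * (-1)) (at u)"
      by (rule DERIV_chain2[OF moment_deriv]) (use assms in \<open>auto intro!: derivative_eq_intros\<close>)
    show "(?F has_real_derivative real (Suc m) * (exp (r * (real (Suc m))\<^sup>2 * (u - s)) * moment r m (t - u))) (at u)"
      by (rule derivative_eq_intros moment' refl)+ (simp add: algebra_simps)
  qed
  thus ?thesis by (simp add: moment_at_0)
qed

text \<open>
  The summands at \<open>l\<close> and \<open>2 * m - l\<close> agree, so the full sum is twice its lower half, except that
  the middle summand \<open>(- 1) ^ m * (2 * m choose m)\<close> must not be doubled.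
\<close>
lemma moment_closed_form:
  assumes "m \<ge> 1" "r > 0" "T > 0"
  shows "moment r m T / T ^ m = Gamma (real m) / Gamma (real (2 * m)) * (r * T) powi (- int m) *
      (- (1 / 2) * (- 1) ^ m * real ((2 * m) choose m) +
       (\<Sum>l = 0..m. real ((2 * m) choose l) * (- 1) ^ l * exp (r * T * (real m - real l)\<^sup>2)))"
proof -
  let ?g = "\<lambda>l. real (2 * m choose l) * (- 1) ^ l * exp (r * T * (real m - real l)\<^sup>2)"
  have split: "{..2*m} = {..m} \<union> {Suc m..2*m}" by auto
  have "(\<Sum>l\<in>{Suc m..2*m}. ?g l) = (\<Sum>l\<in>{..<m}. ?g l)"
  proof (rule sum.reindex_bij_witness[of _ "\<lambda>l. 2*m - l" "\<lambda>l. 2*m - l"])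
    fix l assume l: "l \<in> {Suc m..2*m}"
    then obtain k where k: "2 * m = l + k" "k \<le> m" by (auto simp: le_iff_add)
    have "(-1::real) ^ k = (-1) ^ l"
      by (metis k(1) even_add even_mult_iff even_numeral minus_one_power_iff)
    moreover have "(real m - real k)\<^sup>2 = (real m - real l)\<^sup>2"
    proof -
      have "real m - real k = - (real m - real l)" using arg_cong[OF k(1), of real] by simp
      thus ?thesis by (simp only: power2_minus)
    qed
    moreover have "2*m choose k = (2*m choose l)"
      using binomial_symmetric[of l "2*m"] k by simp
    moreover have "2*m - l = k" using k by simp
    ultimately show "?g (2*m - l) = ?g l" by simp
  qed auto
  hence "(\<Sum>l\<le>2*m. ?g l) = (\<Sum>l\<le>m. ?g l) + (\<Sum>l<m. ?g l)"
    unfolding split by (subst sum.union_disjoint) auto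
  also have "(\<Sum>l<m. ?g l) = (\<Sum>l\<le>m. ?g l) - ?g m"
    by (simp add: lessThan_Suc_atMost[symmetric])
  finally have 1: "(\<Sum>l\<le>2*m. ?g l) =
     2 * (- (1 / 2) * (- 1) ^ m * real ((2 * m) choose m) + (\<Sum>l = 0..m. ?g l))"
    by (simp add: atLeast0AtMost)
  have 2: "Gamma (real m) / Gamma (real (2 * m)) = 2 * fact m / fact (2 * m)"
  proof -
    obtain k where k: "m = Suc k" using assms(1) by (cases m) auto
    have "2 * m = Suc (Suc (2 * k))" using k by simp
    hence "Gamma (real (2 * m)) = fact (Suc (2*k))"
      using Gamma_fact[of "Suc (2*k)", where ?'a = real] by (simp add: add_ac)
    moreover have "Gamma (real m) = fact k" using Gamma_fact[of k, where ?'a = real] k by (simp add: add_ac)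
    ultimately show ?thesis by (simp add: k divide_simps)
  qed
  show ?thesis
    unfolding moment_def 1 2 using assms
    by (simp add: power_int_minus power_mult_distrib field_simps)
qed

section \<open>Gaussian exponentials and powers of tail integrals\<close>

text \<open>Completing the square turns the integrand into a multiple of a shifted normal density.\<close>
lemma nn_integral_normal_exp:
  assumes "\<tau> > 0"
  shows "(\<integral>\<^sup>+x. ennreal (normal_density 0 \<tau> x) * ennreal (exp (c * x)) \<partial>lborel) = ennreal (exp (c\<^sup>2 * \<tau>\<^sup>2 / 2))"
proof -
  have "normal_density 0 \<tau> x * exp (c * x) = exp (c\<^sup>2 * \<tau>\<^sup>2 / 2) * normal_density (c * \<tau>\<^sup>2) \<tau> x" for x
  proof -
    have "- (x - 0)\<^sup>2 / (2 * \<tau>\<^sup>2) + c * x = c\<^sup>2 * \<tau>\<^sup>2 / 2 + - (x - c * \<tau>\<^sup>2)\<^sup>2 / (2 * \<tau>\<^sup>2)"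
      using assms by (simp add: field_simps power2_eq_square)
    hence "exp (- (x - 0)\<^sup>2 / (2 * \<tau>\<^sup>2)) * exp (c * x) = exp (c\<^sup>2 * \<tau>\<^sup>2 / 2) * exp (- (x - c * \<tau>\<^sup>2)\<^sup>2 / (2 * \<tau>\<^sup>2))"
      by (simp only: exp_add[symmetric])
    thus ?thesis by (simp add: normal_density_def mult_ac)
  qed
  hence "(\<integral>\<^sup>+x. ennreal (normal_density 0 \<tau> x) * ennreal (exp (c * x)) \<partial>lborel) =
     (\<integral>\<^sup>+x. ennreal (exp (c\<^sup>2 * \<tau>\<^sup>2 / 2)) * ennreal (normal_density (c * \<tau>\<^sup>2) \<tau> x) \<partial>lborel)"
    by (simp add: ennreal_mult'[symmetric])
  also have "\<dots> = ennreal (exp (c\<^sup>2 * \<tau>\<^sup>2 / 2)) * (\<integral>\<^sup>+x. ennreal (normal_density (c * \<tau>\<^sup>2) \<tau> x) \<partial>lborel)"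
    by (simp add: nn_integral_cmult)
  also have "(\<integral>\<^sup>+x. ennreal (normal_density (c * \<tau>\<^sup>2) \<tau> x) \<partial>lborel) = 1"
    using prob_space.emeasure_space_1[OF prob_space_normal_density[OF assms, of "c * \<tau>\<^sup>2"]]
    by (simp add: emeasure_density)
  finally show ?thesis by simp
qed

text \<open>
  The integrand is the derivative of \<open>- (\<integral>\<^bsub>u\<^esub>\<^bsup>t\<^esup> f) ^ (m + 1)\<close> in \<open>u\<close>. Iterating the identity would
  express the power as \<open>(m + 1)!\<close> times an integral over increasing times.
\<close>
lemma nn_integral_power_tail_integral:
  fixes f :: "real \<Rightarrow> real"
  assumes f: "continuous_on {s..t} f" and nonneg: "\<And>u. u \<in> {s..t} \<Longrightarrow> f u \<ge> 0" and "s \<le> t"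
  shows "(\<integral>\<^sup>+u\<in>{s..t}. ennreal (real (Suc m) * (f u * integral {u..t} f ^ m)) \<partial>lborel)
    = ennreal (integral {s..t} f ^ Suc m)"
proof -
  let ?g = "\<lambda>u. real (Suc m) * (f u * integral {u..t} f ^ m)"
  have d: "((\<lambda>u. integral {u..t} f) has_real_derivative - f u) (at u within {s..t})" if "u \<in> {s..t}" for u
    using integral_has_real_derivative'[OF f that] .
  have cI: "continuous_on {s..t} (\<lambda>u. integral {u..t} f)"
    using d by (meson DERIV_continuous_on)
  have cg: "continuous_on {s..t} ?g"
    by (intro continuous_intros f cI)
  have nn: "0 \<le> ?g u" if u: "u \<in> {s..t}" for u
  proof -
    have "0 \<le> integral {u..t} f"
      by (rule integral_nonneg)
         (use u nonneg f in \<open>auto intro!: integrable_continuous_interval intro: continuous_on_subset\<close>)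
    thus ?thesis using nonneg[OF u] by simp
  qed
  have "(?g has_integral (- (integral {t..t} f ^ Suc m) - - (integral {s..t} f ^ Suc m))) {s..t}"
  proof (rule fundamental_theorem_of_calculus[OF \<open>s \<le> t\<close>])
    fix u assume u: "u \<in> {s..t}"
    have "((\<lambda>u. - (integral {u..t} f ^ Suc m)) has_real_derivative ?g u) (at u within {s..t})"
      by (rule derivative_eq_intros d[OF u] refl)+ simp
    thus "((\<lambda>u. - (integral {u..t} f ^ Suc m)) has_vector_derivative ?g u) (at u within {s..t})"
      by (simp only: has_real_derivative_iff_has_vector_derivative)
  qed
  hence I: "integral {s..t} ?g = integral {s..t} f ^ Suc m"
    using integral_unique[of ?g "integral {s..t} f ^ Suc m" "{s..t}"] by simp
  have si: "set_integrable lborel {s..t} ?g"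
    using borel_integrable_compact[OF compact_Icc cg]
    by (simp add: set_integrable_def)
  have "(\<integral>\<^sup>+u\<in>{s..t}. ennreal (?g u) \<partial>lborel) = (\<integral>\<^sup>+u. ennreal (indicator {s..t} u *\<^sub>R ?g u) \<partial>lborel)"
    by (intro nn_integral_cong) (simp add: indicator_def)
  also have "\<dots> = ennreal (LINT u|lborel. indicator {s..t} u *\<^sub>R ?g u)"
    by (rule nn_integral_eq_integral)
       (use si nn in \<open>auto simp: set_integrable_def indicator_def\<close>)
  also have "(LINT u|lborel. indicator {s..t} u *\<^sub>R ?g u) = integral {s..t} ?g"
    using set_borel_integral_eq_integral(2)[OF si] by (simp only: set_lebesgue_integral_def)
  finally show ?thesis unfolding I .
qed

section \<open>Path integrals of exponential Brownian motion\<close>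

context standard_brownian_motion
begin

text \<open>
  Continuity of the paths makes \<open>B\<close> the limit of the processes that round time down to the grid
  of multiples of \<open>1 / (n + 1)\<close>, and those are measurable because the grid is countable. Clipping
  time at \<open>0\<close> extends the process to the whole line, so that its arguments range over \<open>borel\<close>
  and not over a restricted measurable space.
\<close>
lemma measurable_process: "(\<lambda>(t, \<omega>). B (max 0 t) \<omega>) \<in> borel_measurable (borel \<Otimes>\<^sub>M M)"
proof -
  let ?q = "\<lambda>n t. real_of_int \<lfloor>t * real (Suc n)\<rfloor> / real (Suc n)"
  have lim: "(\<lambda>n. ?q n t) \<longlonglongrightarrow> t" for t
  proof (rule tendsto_sandwich)
    show "\<forall>\<^sub>F n in sequentially. t - inverse (real (Suc n)) \<le> ?q n t"
    proof (rule always_eventually, rule allI)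
      fix n show "t - inverse (real (Suc n)) \<le> ?q n t"
        using divide_right_mono[OF real_of_int_floor_add_one_ge[of "t * real (Suc n)"], of "real (Suc n)"]
        by (simp add: add_divide_distrib inverse_eq_divide del: of_nat_Suc)
    qed
    show "\<forall>\<^sub>F n in sequentially. ?q n t \<le> t"
      by (rule always_eventually) (simp add: pos_divide_le_eq del: of_nat_Suc)
    show "(\<lambda>n. t - inverse (real (Suc n))) \<longlonglongrightarrow> t"
      using tendsto_diff[OF tendsto_const LIMSEQ_inverse_real_of_nat] by simp
  qed simp
  show ?thesis
  proof (rule borel_measurable_LIMSEQ_metric)
    fix n
    have "(\<lambda>p. B (max 0 (real_of_int (\<lfloor>fst p * real (Suc n)\<rfloor>) / real (Suc n))) (snd p)) \<in> borel_measurable (borel \<Otimes>\<^sub>M M)"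
    proof (rule measurable_compose_countable[where g = "\<lambda>p. \<lfloor>fst p * real (Suc n)\<rfloor>"])
      show "(\<lambda>p. B (max 0 (real_of_int i / real (Suc n))) (snd p)) \<in> borel_measurable (borel \<Otimes>\<^sub>M M)" for i
        by (rule measurable_compose[OF measurable_snd random_variable_B]) simp
      show "(\<lambda>p. \<lfloor>fst p * real (Suc n)\<rfloor>) \<in> borel \<Otimes>\<^sub>M M \<rightarrow>\<^sub>M count_space UNIV"
        by measurable
    qed
    thus "(\<lambda>(t, \<omega>). B (max 0 (?q n t)) \<omega>) \<in> borel_measurable (borel \<Otimes>\<^sub>M M)"
      by (simp add: case_prod_beta')
  next
    fix p assume "p \<in> space (borel \<Otimes>\<^sub>M M :: (real \<times> 'a) measure)"
    then obtain t \<omega> where p: "p = (t, \<omega>)" "\<omega> \<in> space M"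
      by (auto simp: space_pair_measure)
    have "(\<lambda>n. max 0 (?q n t)) \<longlonglongrightarrow> max 0 t"
      by (intro tendsto_max tendsto_const lim)
    hence "(\<lambda>n. B (max 0 (?q n t)) \<omega>) \<longlonglongrightarrow> B (max 0 t) \<omega>"
      by (rule continuous_on_tendsto_compose[OF continuous_paths[OF p(2)]]) auto
    thus "(\<lambda>n. case p of (t, \<omega>) \<Rightarrow> B (max 0 (?q n t)) \<omega>) \<longlonglongrightarrow> (case p of (t, \<omega>) \<Rightarrow> B (max 0 t) \<omega>)"
      by (simp add: p)
  qed
qed

lemma measurable_process'[measurable (raw)]:
  assumes [measurable]: "f \<in> borel_measurable N" "g \<in> N \<rightarrow>\<^sub>M M"
  shows "(\<lambda>x. B (max 0 (f x)) (g x)) \<in> borel_measurable N"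
  using measurable_compose[OF measurable_Pair[OF assms] measurable_process] by simp

lemma continuous_exp_path:
  assumes "\<omega> \<in> space M" "0 \<le> s"
  shows "continuous_on {s..t} (\<lambda>u. exp (\<sigma> * B u \<omega>))"
  by (intro continuous_intros continuous_on_subset[OF continuous_paths[OF assms(1)]]) (use assms in auto)

text \<open>
  As a gauge integral, this satisfies the fundamental theorem of calculus up to the end points of
  the interval; \<open>area_eq_LINT\<close> turns it into a Lebesgue integral, which depends measurably on
  parameters.
\<close>
definition area :: "real \<Rightarrow> real \<Rightarrow> real \<Rightarrow> 'a \<Rightarrow> real" where
  "area \<sigma> s t \<omega> = integral {s..t} (\<lambda>u. exp (\<sigma> * B u \<omega>))"

lemma area_eq_LINT:
  assumes "\<omega> \<in> space M" "0 \<le> s"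
  shows "area \<sigma> s t \<omega> = (LINT u|lborel. indicator {s..t} u * exp (\<sigma> * B (max 0 u) \<omega>))"
proof -
  have "set_integrable lborel {s..t} (\<lambda>u. exp (\<sigma> * B u \<omega>))"
    using borel_integrable_compact[OF compact_Icc continuous_exp_path[OF assms]]
    by (simp add: set_integrable_def)
  from set_borel_integral_eq_integral(2)[OF this]
  have "area \<sigma> s t \<omega> = (LINT u|lborel. indicator {s..t} u * exp (\<sigma> * B u \<omega>))"
    by (simp add: area_def set_lebesgue_integral_def)
  also have "\<dots> = (LINT u|lborel. indicator {s..t} u * exp (\<sigma> * B (max 0 u) \<omega>))"
    by (intro Bochner_Integration.integral_cong) (use assms in \<open>auto simp: indicator_def\<close>)
  finally show ?thesis .
qed

lemma area_nonneg:
  assumes "\<omega> \<in> space M" "0 \<le> s"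
  shows "0 \<le> area \<sigma> s t \<omega>"
  unfolding area_eq_LINT[OF assms] by simp

lemma measurable_area:
  assumes [measurable]: "f \<in> borel_measurable N" "g \<in> N \<rightarrow>\<^sub>M M"
  shows "(\<lambda>x. area \<sigma> (max 0 (f x)) t (g x)) \<in> borel_measurable N"
proof -
  have [measurable]: "Measurable.pred (N \<Otimes>\<^sub>M lborel) (\<lambda>p. snd p \<in> {max 0 (f (fst p))..t})"
    unfolding atLeastAtMost_iff by measurable
  have "(\<lambda>x. LINT u|lborel. indicator {max 0 (f x)..t} u * exp (\<sigma> * B (max 0 u) (g x))) \<in> borel_measurable N"
    by measurable
  thus ?thesis
    by (subst measurable_cong[OF area_eq_LINT]) (use measurable_space[OF assms(2)] in auto)
qed

section \<open>Moments\<close>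

text \<open>
  Summation by parts: the increment over \<open>[v j, v (j + 1)]\<close> contributes to the value of \<open>B\<close> at each
  of the \<open>n - j\<close> times \<open>v (j + 1), \<dots>, v n\<close>.
\<close>
lemma sum_values_eq_weighted_increments:
  assumes "\<omega> \<in> space M" "v 0 = 0"
  shows "(\<Sum>i<n. B (v (Suc i)) \<omega>) = (\<Sum>j<n. (real n - real j) * (B (v (Suc j)) \<omega> - B (v j) \<omega>))"
proof (induction n)
  case (Suc n)
  have "B (v (Suc n)) \<omega> = (\<Sum>j<Suc n. B (v (Suc j)) \<omega> - B (v j) \<omega>)"
    using B_zero[OF assms(1)] assms(2) by (subst sum_lessThan_telescope) simp
  hence "(\<Sum>i<Suc n. B (v (Suc i)) \<omega>) = (\<Sum>j<n. (real n - real j) * (B (v (Suc j)) \<omega> - B (v j) \<omega>))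
     + (\<Sum>j<Suc n. B (v (Suc j)) \<omega> - B (v j) \<omega>)" using Suc by simp
  also have "\<dots> = (\<Sum>j<Suc n. (real n - real j) * (B (v (Suc j)) \<omega> - B (v j) \<omega>)) + (\<Sum>j<Suc n. B (v (Suc j)) \<omega> - B (v j) \<omega>)"
    by simp
  also have "\<dots> = (\<Sum>j<Suc n. (real (Suc n) - real j) * (B (v (Suc j)) \<omega> - B (v j) \<omega>))"
    unfolding sum.distrib[symmetric] by (intro sum.cong) (auto simp: algebra_simps)
  finally show ?case .
qed simp

lemma nn_integral_exp_increment:
  assumes "0 \<le> s" "s < t"
  shows "(\<integral>\<^sup>+\<omega>. ennreal (exp (c * (B t \<omega> - B s \<omega>))) \<partial>M) = ennreal (exp (c\<^sup>2 * (t - s) / 2))"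
  using distributed_nn_integral[OF normal_increments[OF assms], of "\<lambda>x. ennreal (exp (c * x))"]
    nn_integral_normal_exp[of "sqrt (t - s)" c] assms
  by simp

lemma nn_integral_exp_sum:
  assumes v0: "v 0 = 0" and v: "\<And>i. i < n \<Longrightarrow> v i < v (Suc i)"
  shows "(\<integral>\<^sup>+\<omega>. ennreal (exp (\<sigma> * (\<Sum>i<n. B (v (Suc i)) \<omega>))) \<partial>M) =
    ennreal (exp (\<sigma>\<^sup>2 / 2 * (\<Sum>j<n. (real n - real j)\<^sup>2 * (v (Suc j) - v j))))"
proof -
  have v_nonneg: "0 \<le> v i" if "i \<le> n" for i
    using that
  proof (induction i)
    case (Suc i) thus ?case using v[of i] by simp
  qed (simp add: v0)
  let ?Y = "\<lambda>j x. ennreal (exp (\<sigma> * (real n - real j) * x))"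
  have "(\<integral>\<^sup>+\<omega>. ennreal (exp (\<sigma> * (\<Sum>i<n. B (v (Suc i)) \<omega>))) \<partial>M)
     = (\<integral>\<^sup>+\<omega>. (\<Prod>j<n. ?Y j (B (v (Suc j)) \<omega> - B (v j) \<omega>)) \<partial>M)"
    by (intro nn_integral_cong, subst sum_values_eq_weighted_increments[of _ v, OF _ v0], assumption)
       (simp add: prod_ennreal exp_sum[symmetric] sum_distrib_left mult_ac)
  also have "\<dots> = (\<Prod>j<n. \<integral>\<^sup>+\<omega>. ?Y j (B (v (Suc j)) \<omega> - B (v j) \<omega>) \<partial>M)"
    by (rule indep_vars_nn_integral, simp, rule indep_vars_compose2[OF indep_increments])
       (use v v0 in auto)
  also have "\<dots> = (\<Prod>j<n. ennreal (exp ((\<sigma> * (real n - real j))\<^sup>2 * (v (Suc j) - v j) / 2)))"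
    by (intro prod.cong refl nn_integral_exp_increment) (use v v_nonneg in auto)
  also have "\<dots> = ennreal (exp (\<sigma>\<^sup>2 / 2 * (\<Sum>j<n. (real n - real j)\<^sup>2 * (v (Suc j) - v j))))"
    by (simp add: prod_ennreal exp_sum[symmetric] sum_distrib_left power_mult_distrib mult_ac)
  finally show ?thesis .
qed


text \<open>
  The factors \<open>exp (\<sigma> * B (v i))\<close> at earlier times are what makes the induction on \<open>m\<close> work:
  the step appends the integration variable \<open>u\<close> to the list of times and replaces the
  starting time \<open>v n\<close> by \<open>u\<close>. The increment over \<open>[v j, v (j + 1)]\<close> enters the \<open>n - j\<close> factors
  after it and each of the \<open>m\<close> integrals, whence the weight \<open>n + m - j\<close>; passing from \<open>(n, m + 1)\<close> to
  \<open>(n + 1, m)\<close> leaves them unchanged.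
\<close>
lemma nn_integral_exp_sum_times_power_area:
  assumes r: "r = \<sigma>\<^sup>2 / 2" "r > 0"
    and "v 0 = 0" "\<And>i. i < n \<Longrightarrow> v i < v (Suc i)" "v n \<le> t"
  shows "(\<integral>\<^sup>+\<omega>. ennreal (exp (\<sigma> * (\<Sum>i<n. B (v (Suc i)) \<omega>)) * area \<sigma> (v n) t \<omega> ^ m) \<partial>M) =
    ennreal (exp (r * (\<Sum>j<n. (real (n + m) - real j)\<^sup>2 * (v (Suc j) - v j))) * moment r m (t - v n))"
  using assms(3-)
proof (induction m arbitrary: n v)
  case 0
  thus ?case using nn_integral_exp_sum[of v n \<sigma>] by (simp add: moment_0 r(1))
next
  case (Suc m)
  note v0 = Suc.prems(1) and v = Suc.prems(2) and vt = Suc.prems(3)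
  have v_nonneg: "0 \<le> v i" if "i \<le> n" for i
    using that
  proof (induction i)
    case (Suc i) thus ?case using v[of i] by simp
  qed (simp add: v0)
  define s where "s = v n"
  have s: "0 \<le> s" "s \<le> t" using v_nonneg vt by (auto simp: s_def)
  let ?P = "\<lambda>\<omega>. exp (\<sigma> * (\<Sum>i<n. B (v (Suc i)) \<omega>))"
  \<comment> \<open>Clipped times keep the integrand jointly measurable in \<open>u\<close> and \<open>\<omega>\<close>.\<close>
  let ?E = "\<lambda>u \<omega>. exp (\<sigma> * (\<Sum>i<n. B (v (Suc i)) \<omega>) + \<sigma> * B (max 0 u) \<omega>) * area \<sigma> (max 0 u) t \<omega> ^ m"
  let ?c = "exp (r * (\<Sum>j<n. (real (n + Suc m) - real j)\<^sup>2 * (v (Suc j) - v j)))"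
  let ?k = "\<lambda>u. exp (r * (real (Suc m))\<^sup>2 * (u - s)) * moment r m (t - u)"
  note measurable_area[measurable (raw)]
  have rvB: "(\<lambda>\<omega>. B (v (Suc i)) \<omega>) \<in> borel_measurable M" if "i < n" for i
    using v_nonneg[of "Suc i"] that by (intro random_variable_B) auto
  have [measurable]: "(\<lambda>\<omega>. \<Sum>i<n. B (v (Suc i)) \<omega>) \<in> borel_measurable M"
    by (intro borel_measurable_sum rvB) simp
  have path: "ennreal (?P \<omega> * area \<sigma> s t \<omega> ^ Suc m) =
      (\<integral>\<^sup>+u. ennreal (real (Suc m) * ?E u \<omega>) * indicator {s..t} u \<partial>lborel)" if \<omega>: "\<omega> \<in> space M" for \<omega>
  proof -
    have "ennreal (?P \<omega> * area \<sigma> s t \<omega> ^ Suc m) = ennreal (?P \<omega>) * ennreal (area \<sigma> s t \<omega> ^ Suc m)"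
      by (simp add: ennreal_mult')
    also have "ennreal (area \<sigma> s t \<omega> ^ Suc m) =
       (\<integral>\<^sup>+u\<in>{s..t}. ennreal (real (Suc m) * (exp (\<sigma> * B u \<omega>) * area \<sigma> u t \<omega> ^ m)) \<partial>lborel)"
      unfolding area_def
      by (rule nn_integral_power_tail_integral[symmetric]) (use continuous_exp_path \<omega> s in auto)
    also have "\<dots> = (\<integral>\<^sup>+u. ennreal (real (Suc m) * (exp (\<sigma> * B (max 0 u) \<omega>) * area \<sigma> (max 0 u) t \<omega> ^ m))
        * indicator {s..t} u \<partial>lborel)"
      by (intro nn_integral_cong) (use s in \<open>auto simp: indicator_def max_def\<close>)
    also have "ennreal (?P \<omega>) * \<dots> = (\<integral>\<^sup>+u. ennreal (?P \<omega>) *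
        (ennreal (real (Suc m) * (exp (\<sigma> * B (max 0 u) \<omega>) * area \<sigma> (max 0 u) t \<omega> ^ m))
        * indicator {s..t} u) \<partial>lborel)"
      using \<omega> by (intro nn_integral_cmult[symmetric]) measurable
    also have "\<dots> = (\<integral>\<^sup>+u. ennreal (real (Suc m) * ?E u \<omega>) * indicator {s..t} u \<partial>lborel)"
    proof (rule nn_integral_cong)
      fix u
      have "real (Suc m) * ?E u \<omega> =
          ?P \<omega> * (real (Suc m) * (exp (\<sigma> * B (max 0 u) \<omega>) * area \<sigma> (max 0 u) t \<omega> ^ m))"
        by (simp add: exp_add del: of_nat_Suc)
      thus "ennreal (?P \<omega>) * (ennreal (real (Suc m) * (exp (\<sigma> * B (max 0 u) \<omega>) * area \<sigma> (max 0 u) t \<omega> ^ m))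
          * indicator {s..t} u) = ennreal (real (Suc m) * ?E u \<omega>) * indicator {s..t} u"
        by (simp only: ennreal_mult' exp_ge_zero mult.assoc)
    qed
    finally show ?thesis .
  qed
  interpret pair_sigma_finite lborel M ..
  have "(\<integral>\<^sup>+\<omega>. ennreal (?P \<omega> * area \<sigma> s t \<omega> ^ Suc m) \<partial>M) =
     (\<integral>\<^sup>+\<omega>. (\<integral>\<^sup>+u. ennreal (real (Suc m) * ?E u \<omega>) * indicator {s..t} u \<partial>lborel) \<partial>M)"
    by (intro nn_integral_cong path)
  also have "\<dots> = (\<integral>\<^sup>+u. (\<integral>\<^sup>+\<omega>. ennreal (real (Suc m) * ?E u \<omega>) * indicator {s..t} u \<partial>M) \<partial>lborel)"
    by (rule Fubini') measurable
  also have "\<dots> = (\<integral>\<^sup>+u. ennreal ?c * (ennreal (real (Suc m) * ?k u) * indicator {s..t} u) \<partial>lborel)"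
  proof (rule nn_integral_cong_AE)
    \<comment> \<open>Independence of increments requires strictly increasing times, so \<open>u = s\<close> must be left out.\<close>
    have "AE u in lborel. u \<noteq> s" by (rule AE_lborel_singleton)
    thus "AE u in lborel. (\<integral>\<^sup>+\<omega>. ennreal (real (Suc m) * ?E u \<omega>) * indicator {s..t} u \<partial>M) =
       ennreal ?c * (ennreal (real (Suc m) * ?k u) * indicator {s..t} u)"
    proof eventually_elim
      case (elim u)
      show ?case
      proof (cases "u \<in> {s..t}")
        case True
        hence u: "s < u" "u \<le> t" "0 \<le> u" "max 0 u = u" using elim s by auto
        let ?w = "v(Suc n := u)"
        have "(\<integral>\<^sup>+\<omega>. ennreal (real (Suc m) * ?E u \<omega>) \<partial>M) =
           (\<integral>\<^sup>+\<omega>. ennreal (real (Suc m)) * ennreal (?E u \<omega>) \<partial>M)"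
          by (intro nn_integral_cong) (simp only: ennreal_mult' of_nat_0_le_iff)
        also have "\<dots> = ennreal (real (Suc m)) * (\<integral>\<^sup>+\<omega>. ennreal (?E u \<omega>) \<partial>M)"
          by (rule nn_integral_cmult) measurable
        also have "(\<integral>\<^sup>+\<omega>. ennreal (?E u \<omega>) \<partial>M) =
           (\<integral>\<^sup>+\<omega>. ennreal (exp (\<sigma> * (\<Sum>i<Suc n. B (?w (Suc i)) \<omega>)) * area \<sigma> (?w (Suc n)) t \<omega> ^ m) \<partial>M)"
          by (intro nn_integral_cong) (simp add: u distrib_left)
        also have "\<dots> = ennreal (exp (r * (\<Sum>j<Suc n. (real (Suc n + m) - real j)\<^sup>2 * (?w (Suc j) - ?w j)))
           * moment r m (t - ?w (Suc n)))"
          by (rule Suc.IH) (use v v0 u in \<open>auto simp: s_def less_Suc_eq\<close>)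
        also have "exp (r * (\<Sum>j<Suc n. (real (Suc n + m) - real j)\<^sup>2 * (?w (Suc j) - ?w j)))
           = ?c * exp (r * (real (Suc m))\<^sup>2 * (u - s))"
          by (simp add: s_def exp_add[symmetric] distrib_left mult.assoc add_ac)
        finally have "(\<integral>\<^sup>+\<omega>. ennreal (real (Suc m) * ?E u \<omega>) \<partial>M) = ennreal ?c * ennreal (real (Suc m) * ?k u)"
          by (simp only: ennreal_mult' exp_ge_zero of_nat_0_le_iff mult_nonneg_nonneg fun_upd_same)
             (simp only: mult_ac)
        thus ?thesis using True by simp
      qed simp
    qed
  qed
  also have "\<dots> = ennreal ?c * (\<integral>\<^sup>+u\<in>{s..t}. ennreal (real (Suc m) * ?k u) \<partial>lborel)"
    by (intro nn_integral_cmult borel_measurable_times_ennreal measurable_compose[OF _ measurable_ennreal])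
       (auto intro!: borel_measurable_continuous_onI continuous_intros continuous_on_moment)
  also have "\<dots> = ennreal ?c * ennreal (moment r (Suc m) (t - s))"
    by (simp only: nn_integral_moment[OF r(2) s(2)])
  finally show ?case by (simp add: ennreal_mult' s_def)
qed

lemma expectation_power_area:
  assumes "r = \<sigma>\<^sup>2 / 2" "r > 0" "T \<ge> 0"
  shows "expectation (\<lambda>\<omega>. area \<sigma> 0 T \<omega> ^ m) = moment r m T"
proof -
  have meas: "area \<sigma> 0 T \<in> borel_measurable M"
    using measurable_area[of "\<lambda>_. 0" M "\<lambda>\<omega>. \<omega>" \<sigma> T] by simp
  have "(\<integral>\<^sup>+\<omega>. ennreal (area \<sigma> 0 T \<omega> ^ m) \<partial>M) = ennreal (moment r m T)"
    using nn_integral_exp_sum_times_power_area[OF assms(1,2), of "\<lambda>_. 0" 0 T m] assms(3) by simp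
  thus ?thesis
    by (subst integral_eq_nn_integral) (use meas assms(2,3) moment_nonneg area_nonneg in auto)
qed

end

theorem theorem3p5:
  fixes M :: "'a measure" and B S :: "real \<Rightarrow> 'a \<Rightarrow> real" and A :: "'a \<Rightarrow> real"
    and \<sigma> T r :: real and m :: nat
  assumes "\<sigma> > 0" and "T > 0" and "r = \<sigma>\<^sup>2 / 2"
    and "standard_brownian_motion M B"
    and "\<And>t \<omega>. t \<ge> 0 \<Longrightarrow> \<omega> \<in> space M \<Longrightarrow> S t \<omega> = exp ((r - \<sigma>\<^sup>2 / 2) * t + \<sigma> * B t \<omega>)"
    and "\<And>\<omega>. \<omega> \<in> space M \<Longrightarrow> A \<omega> = 1 / T * (LINT t:{0..T}|lborel. S t \<omega>)"
    and "m \<ge> 1"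
  shows "prob_space.expectation M (\<lambda>\<omega>. A \<omega> ^ m) =
    Gamma (real m) / Gamma (real (2 * m)) * (r * T) powi (- int m) *
      (- (1 / 2) * (- 1) ^ m * real ((2 * m) choose m) +
       (\<Sum>l = 0..m. real ((2 * m) choose l) * (- 1) ^ l * exp (r * T * (real m - real l)\<^sup>2)))"
proof -
  interpret standard_brownian_motion M B by fact
  have r: "r > 0" using assms(1) by (simp add: assms(3))
  have A: "A \<omega> ^ m = area \<sigma> 0 T \<omega> ^ m / T ^ m" if \<omega>: "\<omega> \<in> space M" for \<omega>
  proof -
    have "(LINT t:{0..T}|lborel. S t \<omega>) = (LINT t|lborel. indicator {0..T} t * exp (\<sigma> * B (max 0 t) \<omega>))"
      unfolding set_lebesgue_integral_def
      by (intro Bochner_Integration.integral_cong) (use \<omega> assms(3,5) in \<open>auto simp: indicator_def\<close>)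
    thus ?thesis using assms(6)[OF \<omega>] area_eq_LINT[OF \<omega>, of 0 \<sigma> T] by (simp add: power_divide)
  qed
  have "expectation (\<lambda>\<omega>. A \<omega> ^ m) = expectation (\<lambda>\<omega>. area \<sigma> 0 T \<omega> ^ m / T ^ m)"
    by (intro Bochner_Integration.integral_cong refl A)
  also have "\<dots> = moment r m T / T ^ m"
    using expectation_power_area[OF assms(3) r, of T m] assms(2) by simp
  also note moment_closed_form[OF assms(7) r assms(2)]
  finally show ?thesis .
qed

end
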